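(* Let $n\ge 4$ be an even integer with $n\notin\{6,10,14,20,26,30,40,60,80,120\}$, and $R_n^4=\langle (n-1)^4,n^4,(n+1)^4\rangle$. The matrix of minimal relations $\mathcal{A}$ of $R_n^4$ (with respect to $d_1=(n-1)^4$, $d_2=n^4$, $d_3=(n+1)^4$) is as follows. $n=40m$, $m\ge 4$: $$\begin{pmatrix}8160m^2+161m+1&-(320m^2-1280m+1)&-(7840m^2-159m+1)\\-(160m^2+m)&320m^2+1&-(160m^2-m)\\-(8000m^2+160m+1)&-1280m&8000m^2-160m+1\end{pmatrix}$$ $n=40m+2$, $m\ge 1$: $$\begin{pmatrix}4640m^2+526m+15&-(4480m^2+64m+6)&-(160m^2-18m-1)\\-(4400m^2+495m+14)&4800m^2+160m+11&-(400m^2+65m+2)\\-(240m^2+31m+1)&-(320m^2+96m+5)&560m^2+47m+1\end{pmatrix}$$ $n=40m+4$, $m\ge 0$: $$\begin{pmatrix}2880m^2+616m+33&-8(320m^2+32m+1)&-(320m^2+40m+1)\\-(2240m^2+473m+25)&2880m^2+448m+25&-(640m^2+135m+7)\\-(640m^2+143m+8)&-(320m^2+192m+17)&960m^2+175m+8\end{pmatrix}$$ $n=40m+6$, $m\ge 1$: $$\begin{pmatrix}2800m^2+885m+70&-(1600m^2+160m-7)&-(1200m^2+325m+22)\\-(1760m^2+550m+43)&1920m^2+448m+30&-(160m^2+58m+5)\\-(1040m^2+335m+27)&-(320m^2+288m+37)&1360m^2+383m+27\end{pmatrix}$$ $n=40m+8$, $m\ge 0$: $$\begin{pmatrix}2240m^2+932m+97&-4(320m^2+64m+1)&-(960m^2+356m+33)\\-(800m^2+325m+33)&1600m^2+640m+69&-(800m^2+315m+31)\\-(1440m^2+607m+64)&-(320m^2+384m+65)&1760m^2+671m+64\end{pmatrix}$$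 $n=40m+10$, $m\ge 1$: $$\begin{pmatrix}2480m^2+1283m+166&-(960m^2+160m-17)&-(1520m^2+723m+86)\\-(640m^2+324m+41)&1280m^2+640m+84&-(640m^2+316m+39)\\-(1840m^2+959m+125)&-(320m^2+480m+101)&2160m^2+1039m+125\end{pmatrix}$$ $n=40m+12$, $m\ge 0$: $$\begin{pmatrix}1280m^2+787m+121&-(960m^2+448m+51)&-(320m^2+179m+25)\\-(320m^2+183m+26)&2240m^2+1472m+247&-(1920m^2+1129m+166)\\-(960m^2+604m+95)&-(1280m^2+1024m+196)&2240m^2+1308m+191\end{pmatrix}$$ $n=40m+14$, $m\ge 1$: $$\begin{pmatrix}2720m^2+1954m+351&-(640m^2+64m-54)&-(2080m^2+1410m+239)\\-(80m^2+51m+8)&960m^2+736m+143&-(880m^2+605m+104)\\-(2640m^2+1903m+343)&-(320m^2+672m+197)&2960m^2+2015m+343\end{pmatrix}$$ $n=40m+16$, $m\ge 0$: $$\begin{pmatrix}1920m^2+1570m+321&-(640m^2+256m+2)&-(1280m^2+994m+193)\\-(800m^2+645m+130)&1600m^2+1280m+261&-(800m^2+635m+126)\\-(1120m^2+925m+191)&-(960m^2+1024m+259)&2080m^2+1629m+319\end{pmatrix}$$ $n=40m+18$, $m\ge 0$: $$\begin{pmatrix}1120m^2+1026m+235&-(640m^2+448m+74)&-(480m^2+418m+91)\\-(1040m^2+937m+211)&2880m^2+2656m+621&-(1840m^2+1639m+365)\\-(80m^2+89m+24)&-(2240m^2+2208m+547)&2320m^2+2057m+456\end{pmatrix}$$ $n=40m+20$,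 $m\ge 2$: $$\begin{pmatrix}4160m^2+4241m+1081&-(320m^2-320m-239)&-(3840m^2+3761m+921)\\-(320m^2+322m+81)&640m^2+640m+162&-(320m^2+318m+79)\\-(3840m^2+3919m+1000)&-(320m^2+960m+401)&4160m^2+4079m+1000\end{pmatrix}$$ $n=40m-18$, $m\ge 1$: $$\begin{pmatrix}2320m^2-2057m+456&-(2240m^2-2208m+547)&-(80m^2-89m+24)\\-(1840m^2-1639m+365)&2880m^2-2656m+621&-(1040m^2-937m+211)\\-(480m^2-418m+91)&-(640m^2-448m+74)&1120m^2-1026m+235\end{pmatrix}$$ $n=40m-16$, $m\ge 1$: $$\begin{pmatrix}2080m^2-1629m+319&-(960m^2-1024m+259)&-(1120m^2-925m+191)\\-(800m^2-635m+126)&1600m^2-1280m+261&-(800m^2-645m+130)\\-(1280m^2-994m+193)&-(640m^2-256m+2)&1920m^2-1570m+321\end{pmatrix}$$ $n=40m-14$, $m\ge 2$: $$\begin{pmatrix}2960m^2-2015m+343&-(320m^2-672m+197)&-(2640m^2-1903m+343)\\-(880m^2-605m+104)&960m^2-736m+143&-(80m^2-51m+8)\\-(2080m^2-1410m+239)&-(640m^2-64m-54)&2720m^2-1954m+351\end{pmatrix}$$ $n=40m-12$, $m\ge 1$: $$\begin{pmatrix}2240m^2-1308m+191&-4(320m^2-256m+49)&-(960m^2-604m+95)\\-(1920m^2-1129m+166)&2240m^2-1472m+247&-(320m^2-183m+26)\\-(320m^2-179m+25)&-(960m^2-448m+51)&1280m^2-787m+121\end{pmatrix}$$ $n=40m-10$,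 $m\ge 2$: $$\begin{pmatrix}2160m^2-1039m+125&-(320m^2-480m+101)&-(1840m^2-959m+125)\\-(640m^2-316m+39)&1280m^2-640m+84&-(640m^2-324m+41)\\-(1520m^2-723m+86)&-(960m^2-160m-17)&2480m^2-1283m+166\end{pmatrix}$$ $n=40m-8$, $m\ge 1$: $$\begin{pmatrix}1760m^2-671m+64&-(320m^2-384m+65)&-(1440m^2-607m+64)\\-(800m^2-315m+31)&1600m^2-640m+69&-(800m^2-325m+33)\\-(960m^2-356m+33)&-(1280m^2-256m+4)&2240m^2-932m+97\end{pmatrix}$$ $n=40m-6$, $m\ge 1$: $$\begin{pmatrix}1360m^2-383m+27&-(320m^2-288m+37)&-(1040m^2-335m+27)\\-(160m^2-58m+5)&1920m^2-448m+30&-(1760m^2-550m+43)\\-(1200m^2-325m+22)&-(1600m^2-160m-7)&2800m^2-885m+70\end{pmatrix}$$ $n=40m-4$, $m\ge 1$: $$\begin{pmatrix}960m^2-175m+8&-(320m^2-192m+17)&-(640m^2-143m+8)\\-(640m^2-135m+7)&2880m^2-448m+25&-(2240m^2-473m+25)\\-(320m^2-40m+1)&-(2560m^2-256m+8)&2880m^2-616m+33\end{pmatrix}$$ $n=40m-2$, $m\ge 1$: $$\begin{pmatrix}560m^2-47m+1&-(320m^2-96m+5)&-(240m^2-31m+1)\\-(400m^2-65m+2)&4800m^2-160m+11&-(4400m^2-495m+14)\\-(160m^2+18m-1)&-(4480m^2-64m+6)&4640m^2-526m+15\end{pmatrix}$$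
   Context: For positive integers $d_1,d_2,d_3$ with $\gcd(d_1,d_2,d_3)=1$, $S=\langle d_1,d_2,d_3\rangle=\{x_1d_1+x_2d_2+x_3d_3 : x_i\in\mathbb{Z}_{\ge 0}\}$ is the numerical semigroup they generate; $F(S)$ denotes the largest integer not in $S$, and $S$ is symmetric if for every integer $s$ exactly one of $s,F(S)-s$ lies in $S$. For a nonsymmetric $S=\langle d_1,d_2,d_3\rangle$, the matrix of minimal relations is the integer matrix $$\mathcal{A}=\begin{pmatrix}a_{11}&-a_{12}&-a_{13}\\-a_{21}&a_{22}&-a_{23}\\-a_{31}&-a_{32}&a_{33}\end{pmatrix},\qquad a_{ij}\in\mathbb{Z}_{\ge 0},$$ such that $\mathcal{A}(d_1,d_2,d_3)^{T}=0$, the greatest common divisor of the entries of each row is $1$, and for each $i$, with $\{i,j,k\}=\{1,2,3\}$, $a_{ii}=\min\{v\ge 2 : v\,d_i=v_jd_j+v_kd_k \text{ for some } v_j,v_k\in\mathbb{Z}_{\ge 0}\}$. (For nonsymmetric $S$ it is unique.) The semigroups $R_n^4$ with $n\ge 4$ even are nonsymmetric. *)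

theory Defs
  imports "HOL-Analysis.Analysis"
begin

definition semigroup3 :: "int ^ 3 \<Rightarrow> int set" where
  "semigroup3 d = {x1 * d $ 1 + x2 * d $ 2 + x3 * d $ 3 | x1 x2 x3. 0 \<le> x1 \<and> 0 \<le> x2 \<and> 0 \<le> x3}"

definition numerical_generators :: "int ^ 3 \<Rightarrow> bool" where
  "numerical_generators d \<longleftrightarrow> (\<forall>i. 0 < d $ i) \<and> Gcd (range (\<lambda>i. d $ i)) = 1"

(* All negative integers lie outside S, so GREATEST rather than Max of the complement. *)
definition frobenius_number :: "int set \<Rightarrow> int" where
  "frobenius_number S = (GREATEST s. s \<notin> S)"

definition symmetric_semigroup :: "int set \<Rightarrow> bool" where
  "symmetric_semigroup S \<longleftrightarrow> (\<forall>s. (s \<in> S) \<noteq> (frobenius_number S - s \<in> S))"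

(* A is the signed matrix: its off-diagonal entries are the -a_ij with a_ij >= 0.
   The notion is only defined for nonsymmetric numerical semigroups, so these
   requirements are part of the predicate. *)
definition minimal_relations_matrix :: "int ^ 3 \<Rightarrow> int ^ 3 ^ 3 \<Rightarrow> bool" where
  "minimal_relations_matrix d A \<longleftrightarrow>
     numerical_generators d \<and> \<not> symmetric_semigroup (semigroup3 d) \<and>
     (\<forall>i. 0 \<le> A $ i $ i) \<and> (\<forall>i j. i \<noteq> j \<longrightarrow> A $ i $ j \<le> 0) \<and>
     A *v d = 0 \<and>
     (\<forall>i. Gcd (range (\<lambda>j. A $ i $ j)) = 1) \<and>
     (\<forall>i j k. {i, j, k} = UNIV \<longrightarrow>
        A $ i $ i = (LEAST v. 2 \<le> v \<and>
           (\<exists>vj vk. 0 \<le> vj \<and> 0 \<le> vk \<and> v * d $ i = vj * d $ j + vk * d $ k)))"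

definition fourth_powers :: "int \<Rightarrow> int ^ 3" where
  "fourth_powers n = vector [(n - 1) ^ 4, n ^ 4, (n + 1) ^ 4]"

end

(* Write the claimed matrix with rows r1, r2, r3. Its columns sum to zero, its off-diagonal
   entries are negative, and r1 x r2 is the generator vector d, whose entries have gcd 1. Hence r1
   and r2 generate the lattice of all relations, and as r1 + r2 + r3 = 0 every relation is a
   combination of the three rows with nonnegative coefficients, one of them zero. The sign pattern
   then gives the minimality and the uniqueness of each row. The same normal form shows that
   a11 d1 - a32 d2 - (d1 + d2 + d3) and a11 d1 - a23 d3 - (d1 + d2 + d3) are two distinct
   pseudo-Frobenius numbers, so the semigroup is not symmetric. *)

theory Submission
  imports Defs
begin

section \<open>Relation matrices of three coprime integers\<close>

(* Entries are signed, as in the matrix of minimal relations. *)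
definition relation_matrix ::
  "int \<Rightarrow> int \<Rightarrow> int \<Rightarrow> int \<Rightarrow> int \<Rightarrow> int \<Rightarrow> int \<Rightarrow> int \<Rightarrow> int \<Rightarrow> int \<Rightarrow> int \<Rightarrow> int \<Rightarrow> bool" where
  "relation_matrix x y z a11 a12 a13 a21 a22 a23 a31 a32 a33 \<longleftrightarrow>
     a12 < 0 \<and> a13 < 0 \<and> a21 < 0 \<and> a23 < 0 \<and> a31 < 0 \<and> a32 < 0 \<and>
     a11 + a21 + a31 = 0 \<and> a12 + a22 + a32 = 0 \<and> a13 + a23 + a33 = 0 \<and>
     x = a22 * a33 - a23 * a32 \<and> y = a11 * a33 - a13 * a31 \<and> z = a11 * a22 - a12 * a21 \<and>
     gcd x (gcd y z) = 1"

section \<open>Relabelling the generators, and first consequences of the minors\<close>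

text \<open>Cyclic relabelling of the generators: facts proved for the first row carry over to the
  other two.\<close>

lemma relation_matrix_rotate:
  assumes "relation_matrix x y z a11 a12 a13 a21 a22 a23 a31 a32 a33"
  shows "relation_matrix y z x a22 a23 a21 a32 a33 a31 a12 a13 a11"
  using assms unfolding relation_matrix_def
  by (elim conjE, intro conjI) (simp_all only: ac_simps)

lemma relation_matrix_swap:
  assumes "relation_matrix x y z a11 a12 a13 a21 a22 a23 a31 a32 a33"
  shows "relation_matrix x z y a11 a13 a12 a31 a33 a32 a21 a23 a22"
  using assms unfolding relation_matrix_def
  by (elim conjE, intro conjI) (simp_all only: ac_simps)

text \<open>Zero column sums make the determinant vanish and identify the principal minors
  \<open>x\<close>, \<open>y\<close>, \<open>z\<close> with the cofactors of the first row, so this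
  is the expansion of the determinant along that row.\<close>

lemma relation_matrix_row:
  assumes "relation_matrix x y z a11 a12 a13 a21 a22 a23 a31 a32 a33"
  shows "a11 * x + a12 * y + a13 * z = 0"
proof -
  have d: "x = a22 * a33 - a23 * a32" "y = a11 * a33 - a13 * a31" "z = a11 * a22 - a12 * a21"
    and diag: "a11 = - a21 - a31" "a22 = - a12 - a32" "a33 = - a13 - a23"
    using assms unfolding relation_matrix_def by auto
  show ?thesis unfolding d unfolding diag by (simp add: algebra_simps)
qed

lemma relation_matrix_pos:
  assumes "relation_matrix x y z a11 a12 a13 a21 a22 a23 a31 a32 a33"
  shows "0 < x"
proof -
  have s: "a12 < 0" "a32 < 0" "a13 < 0" "a23 < 0" "a22 = - a12 - a32" "a33 = - a13 - a23"
    and x: "x = a22 * a33 - a23 * a32"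
    using assms unfolding relation_matrix_def by auto
  \<comment> \<open>Eliminating the diagonal cancels \<open>a23 * a32\<close>, leaving only products
    of two negative entries.\<close>
  have "x = a12 * a13 + a12 * a23 + a32 * a13"
    unfolding x s by (simp add: algebra_simps)
  then show ?thesis using s by (simp add: add_pos_pos mult_neg_neg)
qed

section \<open>The lattice of relations and its nonnegative normal form\<close>

lemma bezout3_int:
  fixes x y z :: int
  assumes "gcd x (gcd y z) = 1"
  obtains u v w where "u * x + v * y + w * z = 1"
proof -
  obtain a b where 1: "a * x + b * gcd y z = 1"
    using bezout_int[of x "gcd y z"] assms by metis
  obtain c d where 2: "c * y + d * z = gcd y z"
    using bezout_int by blast
  have "a * x + (b * c) * y + (b * d) * z = 1"
    using 1 unfolding 2[symmetric] by (simp add: algebra_simps)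
  then show ?thesis by (rule that)
qed

(* With (u, v, w) . d = 1, a relation r satisfies r = d x (r x (u, v, w)), and d = r1 x r2. *)
lemma relation_lattice:
  assumes M: "relation_matrix x y z a11 a12 a13 a21 a22 a23 a31 a32 a33"
    and rel: "r * x + s * y + t * z = 0"
  obtains p q where "r = p * a11 + q * a21" "s = p * a12 + q * a22" "t = p * a13 + q * a23"
proof -
  have g: "gcd x (gcd y z) = 1" and c: "a31 = - a11 - a21" "a32 = - a12 - a22" "a33 = - a13 - a23"
    and d: "x = a22 * a33 - a23 * a32" "y = a11 * a33 - a13 * a31" "z = a11 * a22 - a12 * a21"
    using M unfolding relation_matrix_def by auto
  obtain u v w where uvw: "u * x + v * y + w * z = 1"
    using bezout3_int[OF g] .
  \<comment> \<open>By the column sums, the principal minors are the coordinates of the cross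
    product of rows 1 and 2.\<close>
  have d': "x = a12 * a23 - a13 * a22" "y = a13 * a21 - a11 * a23" "z = a11 * a22 - a12 * a21"
    unfolding d c by (simp_all add: algebra_simps)
  define e1 e2 e3 where "e1 = s * w - t * v" and "e2 = t * u - r * w" and "e3 = r * v - s * u"
  \<comment> \<open>With r1, r2 the first two rows, (r1 x r2) x e = (r1 . e) r2 - (r2 . e) r1; the
    coefficients are read off from this.\<close>
  define p q where "p = - (a21 * e1 + a22 * e2 + a23 * e3)" and "q = a11 * e1 + a12 * e2 + a13 * e3"
  have "r = r * (u * x + v * y + w * z) - u * (r * x + s * y + t * z)"
    "s = s * (u * x + v * y + w * z) - v * (r * x + s * y + t * z)"
    "t = t * (u * x + v * y + w * z) - w * (r * x + s * y + t * z)"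
    using uvw rel by simp_all
  then have "r = p * a11 + q * a21" "s = p * a12 + q * a22" "t = p * a13 + q * a23"
    unfolding p_def q_def e1_def e2_def e3_def d' by algebra+
  then show ?thesis by (rule that)
qed

text \<open>The rows sum to zero, so the coefficients \<open>p\<close>, \<open>q\<close>,
  \<open>0\<close> may be shifted by a common amount; subtracting their minimum makes all of them
  nonnegative and one of them zero.\<close>

lemma relation_nonneg_combination:
  assumes M: "relation_matrix x y z a11 a12 a13 a21 a22 a23 a31 a32 a33"
    and rel: "r * x + s * y + t * z = 0"
  obtains i j k where "0 \<le> i" "0 \<le> j" "0 \<le> k" "i = 0 \<or> j = 0 \<or> k = 0"
    "r = i * a11 + j * a21 + k * a31" "s = i * a12 + j * a22 + k * a32"
    "t = i * a13 + j * a23 + k * a33"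
proof -
  obtain p q where pq: "r = p * a11 + q * a21" "s = p * a12 + q * a22" "t = p * a13 + q * a23"
    using relation_lattice[OF assms] .
  define m where "m = min 0 (min p q)"
  have c: "a31 = - a11 - a21" "a32 = - a12 - a22" "a33 = - a13 - a23"
    using M unfolding relation_matrix_def by auto
  show ?thesis
    by (rule that[of "p - m" "q - m" "- m"]) (auto simp: pq c m_def algebra_simps)
qed

section \<open>Minimality and uniqueness of the rows\<close>

text \<open>In the normal form of the relation, the signs of \<open>v\<close>, \<open>s\<close> and
  \<open>t\<close> force the coefficient \<open>i\<close> of row 1 to exceed both others. Then
  \<open>v - a11\<close> is a sum of two nonnegative terms, and both vanish only for row 1
  itself.\<close>

lemma relation_first_row:
  assumes M: "relation_matrix x y z a11 a12 a13 a21 a22 a23 a31 a32 a33"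
    and rel: "v * x = s * y + t * z" and v: "0 < v" and s: "0 \<le> s" and t: "0 \<le> t"
  shows "a11 \<le> v \<and> (v = a11 \<longrightarrow> s = - a12 \<and> t = - a13)"
proof -
  have neg: "a12 < 0" "a13 < 0" "a21 < 0" "a23 < 0" "a31 < 0" "a32 < 0"
    and diag: "a11 = - a21 - a31" "a22 = - a12 - a32" "a33 = - a13 - a23"
    using M unfolding relation_matrix_def by auto
  have "v * x + (- s) * y + (- t) * z = 0"
    using rel by simp
  then obtain i j k where nn: "0 \<le> i" "0 \<le> j" "0 \<le> k" and z: "i = 0 \<or> j = 0 \<or> k = 0"
    and e: "v = i * a11 + j * a21 + k * a31" "- s = i * a12 + j * a22 + k * a32"
      "- t = i * a13 + j * a23 + k * a33"
    using relation_nonneg_combination[OF M] by metis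
  have "i \<noteq> 0"
  proof
    assume "i = 0"
    then have "v \<le> 0"
      using e(1) nn neg by (simp add: add_nonpos_nonpos mult_nonneg_nonpos)
    then show False using v by simp
  qed
  then have i: "1 \<le> i" using nn by simp
  \<comment> \<open>Otherwise column 2 would give \<open>- s\<close> a positive value;
    \<open>ki\<close> is the same argument in column 3.\<close>
  have ji: "j < i" if "k = 0"
  proof (rule ccontr)
    assume "\<not> j < i"
    then have "i * a12 + j * a22 = (j - i) * (- a12) + j * (- a32)" "0 \<le> j - i" "0 < j"
      using i by (auto simp: diag algebra_simps)
    moreover have "0 \<le> (j - i) * (- a12)" "0 < j * (- a32)"
      using calculation neg by (simp_all add: mult_nonneg_nonpos mult_pos_neg)
    ultimately have "0 < - s" using e(2) that by simp
    then show False using s by simp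
  qed
  have ki: "k < i" if "j = 0"
  proof (rule ccontr)
    assume "\<not> k < i"
    then have "i * a13 + k * a33 = (k - i) * (- a13) + k * (- a23)" "0 \<le> k - i" "0 < k"
      using i by (auto simp: diag algebra_simps)
    moreover have "0 \<le> (k - i) * (- a13)" "0 < k * (- a23)"
      using calculation neg by (simp_all add: mult_nonneg_nonpos mult_pos_neg)
    ultimately have "0 < - t" using e(3) that by simp
    then show False using t by simp
  qed
  have less: "j \<le> i - 1" "k \<le> i - 1"
    using ji ki z i nn by auto
  have jk: "j = 0 \<or> k = 0" using z i by auto
  have v_eq: "v - a11 = (i - 1 - j) * (- a21) + (i - 1 - k) * (- a31)"
    unfolding e diag by (simp add: algebra_simps)
  have ge: "0 \<le> (i - 1 - j) * (- a21)" "0 \<le> (i - 1 - k) * (- a31)"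
    using less neg by (simp_all add: mult_nonneg_nonpos)
  moreover have "s = - a12 \<and> t = - a13" if "v = a11"
  proof -
    have "(i - 1 - j) * (- a21) = 0" "(i - 1 - k) * (- a31) = 0"
      using ge v_eq that by linarith+
    then have "j = i - 1" "k = i - 1" using neg by auto
    \<comment> \<open>Both \<open>j\<close> and \<open>k\<close> equal \<open>i - 1\<close>, and one
      of them is zero.\<close>
    then have "i = 1" "j = 0" "k = 0" using jk by auto
    then show ?thesis using e by simp
  qed
  ultimately show ?thesis using v_eq by linarith
qed

lemma relation_matrix_Least:
  assumes M: "relation_matrix x y z a11 a12 a13 a21 a22 a23 a31 a32 a33"
  shows "(LEAST v. 2 \<le> v \<and> (\<exists>s t. 0 \<le> s \<and> 0 \<le> t \<and> v * x = s * y + t * z)) = a11"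
proof (rule Least_equality)
  have "a12 < 0" "a13 < 0" "a21 < 0" "a31 < 0" "a11 = - a21 - a31"
    using M unfolding relation_matrix_def by auto
  moreover have "a11 * x = (- a12) * y + (- a13) * z"
    using relation_matrix_row[OF M] by (simp add: algebra_simps)
  \<comment> \<open>The bound 2 holds because \<open>- a21\<close> and \<open>- a31\<close> are both
    positive integers.\<close>
  ultimately show "2 \<le> a11 \<and> (\<exists>s t. 0 \<le> s \<and> 0 \<le> t \<and> a11 * x = s * y + t * z)"
    by (intro conjI exI[of _ "- a12"] exI[of _ "- a13"]) auto
  fix v assume "2 \<le> v \<and> (\<exists>s t. 0 \<le> s \<and> 0 \<le> t \<and> v * x = s * y + t * z)"
  then obtain s t where "2 \<le> v" "0 \<le> s" "0 \<le> t" "v * x = s * y + t * z" by blast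
  then show "a11 \<le> v" using relation_first_row[OF M, of v s t] by simp
qed

lemma Gcd_range_3:
  fixes f :: "3 \<Rightarrow> int"
  shows "Gcd (range f) = gcd (f 1) (gcd (f 2) (f 3))"
  by (simp add: UNIV_3)

text \<open>A common divisor of the first row divides all three minors, hence their gcd, which is 1.
  For \<open>x\<close>, whose formula omits row 1, the column sums bring that row in.\<close>

lemma relation_matrix_gcd_row:
  assumes M: "relation_matrix x y z a11 a12 a13 a21 a22 a23 a31 a32 a33"
  shows "gcd a11 (gcd a12 a13) = 1"
proof -
  let ?g = "gcd a11 (gcd a12 a13)"
  have c: "a22 = - a12 - a32" "a33 = - a13 - a23"
    and d: "x = a22 * a33 - a23 * a32" "y = a11 * a33 - a13 * a31" "z = a11 * a22 - a12 * a21"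
    and g: "gcd x (gcd y z) = 1"
    using M unfolding relation_matrix_def by auto
  have dv: "?g dvd a11" "?g dvd a12" "?g dvd a13"
    by (auto intro: dvd_trans)
  have "x = a12 * (a13 + a23) + a13 * a32"
    unfolding d c by (simp add: algebra_simps)
  then have "?g dvd x" "?g dvd y" "?g dvd z"
    using dv by (simp_all add: d(2,3))
  then have "?g dvd gcd x (gcd y z)" by (intro gcd_greatest)
  then show ?thesis unfolding g by simp
qed

section \<open>Nonsymmetry\<close>

text \<open>Testing the generators suffices, since every nonzero element of the semigroup is a
  generator plus an element of it.\<close>

definition pseudo_frobenius :: "int ^ 3 \<Rightarrow> int \<Rightarrow> bool" where
  "pseudo_frobenius d f \<longleftrightarrow> f \<notin> semigroup3 d \<and> (\<forall>i. f + d $ i \<in> semigroup3 d)"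

lemma semigroup3I:
  assumes "s = i * d $ 1 + j * d $ 2 + k * d $ 3" "0 \<le> i" "0 \<le> j" "0 \<le> k"
  shows "s \<in> semigroup3 d"
  using assms unfolding semigroup3_def by blast

lemma vector_3_nth:
  "(vector [x, y, z] :: 'a::zero ^ 3) $ 1 = x"
  "(vector [x, y, z] :: 'a::zero ^ 3) $ 2 = y"
  "(vector [x, y, z] :: 'a::zero ^ 3) $ 3 = z"
  by simp_all

lemma semigroup3_swap: "semigroup3 (vector [x, z, y]) = semigroup3 (vector [x, y, z])"
proof -
  have "semigroup3 (vector [x, z, y]) \<subseteq> semigroup3 (vector [x, y, z])" for y z
  proof
    fix s assume "s \<in> semigroup3 (vector [x, z, y])"
    then obtain i j k where "s = i * x + j * z + k * y" "0 \<le> i" "0 \<le> j" "0 \<le> k"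
      unfolding semigroup3_def vector_3_nth by blast
    then show "s \<in> semigroup3 (vector [x, y, z])"
      by (intro semigroup3I[of _ i _ k j]) (simp_all only: vector_3_nth ac_simps)
  qed
  then show ?thesis by blast
qed

lemma semigroup3_add:
  assumes "s \<in> semigroup3 d" "t \<in> semigroup3 d"
  shows "s + t \<in> semigroup3 d"
proof -
  obtain i j k i' j' k' where
    "s = i * d $ 1 + j * d $ 2 + k * d $ 3" "0 \<le> i" "0 \<le> j" "0 \<le> k"
    "t = i' * d $ 1 + j' * d $ 2 + k' * d $ 3" "0 \<le> i'" "0 \<le> j'" "0 \<le> k'"
    using assms unfolding semigroup3_def by blast
  then show ?thesis
    by (intro semigroup3I[of _ "i + i'" _ "j + j'" "k + k'"]) (auto simp: algebra_simps)
qed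

lemma semigroup3_nonzeroE:
  assumes "s \<in> semigroup3 d" "s \<noteq> 0"
  obtains i t where "t \<in> semigroup3 d" "s = d $ i + t"
proof -
  obtain i j k where s: "s = i * d $ 1 + j * d $ 2 + k * d $ 3" and nn: "0 \<le> i" "0 \<le> j" "0 \<le> k"
    using assms unfolding semigroup3_def by blast
  have "i \<noteq> 0 \<or> j \<noteq> 0 \<or> k \<noteq> 0" using s assms(2) by auto
  then consider "1 \<le> i" | "1 \<le> j" | "1 \<le> k" using nn by linarith
  then show ?thesis
  proof cases
    case 1
    then have "s - d $ 1 \<in> semigroup3 d"
      using s nn by (intro semigroup3I[of _ "i - 1" _ j k]) (auto simp: left_diff_distrib)
    then show ?thesis by (rule that) simp
  next
    case 2
    then have "s - d $ 2 \<in> semigroup3 d"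
      using s nn by (intro semigroup3I[of _ i _ "j - 1" k]) (auto simp: left_diff_distrib)
    then show ?thesis by (rule that) simp
  next
    case 3
    then have "s - d $ 3 \<in> semigroup3 d"
      using s nn by (intro semigroup3I[of _ i _ j "k - 1"]) (auto simp: left_diff_distrib)
    then show ?thesis by (rule that) simp
  qed
qed

text \<open>Write F for the Frobenius number. If \<open>f\<close> differs from F, symmetry at
  \<open>f\<close> puts the nonzero number F - f into the semigroup. Splitting off a generator shows
  that F lies there too, which contradicts symmetry at 0.\<close>

lemma symmetric_pseudo_frobenius_unique:
  assumes sym: "symmetric_semigroup (semigroup3 d)" and f: "pseudo_frobenius d f"
  shows "f = frobenius_number (semigroup3 d)"
proof (rule ccontr)
  let ?S = "semigroup3 d" and ?F = "frobenius_number (semigroup3 d)"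
  assume "f \<noteq> ?F"
  have "?F - f \<in> ?S" "?F - f \<noteq> 0"
    using spec[OF sym[unfolded symmetric_semigroup_def], of f] f \<open>f \<noteq> ?F\<close>
    by (simp_all add: pseudo_frobenius_def)
  then obtain i t where "t \<in> ?S" "?F - f = d $ i + t"
    by (rule semigroup3_nonzeroE)
  then have "?F = (f + d $ i) + t" "f + d $ i \<in> ?S" "t \<in> ?S"
    using f unfolding pseudo_frobenius_def by auto
  then have "?F \<in> ?S" using semigroup3_add by metis
  moreover have "0 \<in> ?S" by (rule semigroup3I[of _ 0 _ 0 0]) auto
  ultimately show False
    using sym unfolding symmetric_semigroup_def by (metis diff_zero)
qed

lemma relation_matrix_pseudo_frobenius:
  assumes M: "relation_matrix x y z a11 a12 a13 a21 a22 a23 a31 a32 a33"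
  shows "pseudo_frobenius (vector [x, y, z]) (a11 * x - a32 * y - (x + y + z))"
proof -
  let ?d = "vector [x, y, z] :: int ^ 3" and ?f = "a11 * x - a32 * y - (x + y + z)"
  have neg: "a12 < 0" "a13 < 0" "a21 < 0" "a23 < 0" "a31 < 0" "a32 < 0"
    and diag: "a11 = - a21 - a31" "a22 = - a12 - a32" "a33 = - a13 - a23"
    using M unfolding relation_matrix_def by auto
  have row1: "a11 * x + a12 * y + a13 * z = 0"
    using relation_matrix_row[OF M] .
  have row3: "a33 * z + a31 * x + a32 * y = 0"
    using relation_matrix_row[OF relation_matrix_rotate[OF relation_matrix_rotate[OF M]]] .
  have "?f \<notin> semigroup3 ?d"
  proof
    assume "?f \<in> semigroup3 ?d"
    then obtain b1 b2 b3 where f: "?f = b1 * x + b2 * y + b3 * z"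
      and b: "0 \<le> b1" "0 \<le> b2" "0 \<le> b3"
      unfolding semigroup3_def vector_3_nth by blast
    \<comment> \<open>The positive third coordinate forces \<open>k\<close> to be at least 1. Then
      the second coordinate is too small if \<open>j = 0\<close>, and the first is too small if
      \<open>i = 0\<close> and \<open>j\<close> is positive.\<close>
    have "(b1 - a11 + 1) * x + (b2 + a32 + 1) * y + (b3 + 1) * z = 0"
      using f by (simp add: algebra_simps)
    then obtain i j k where nn: "0 \<le> i" "0 \<le> j" "0 \<le> k" and z: "i = 0 \<or> j = 0 \<or> k = 0"
      and e: "b1 - a11 + 1 = i * a11 + j * a21 + k * a31" "b2 + a32 + 1 = i * a12 + j * a22 + k * a32"
        "b3 + 1 = i * a13 + j * a23 + k * a33"
      using relation_nonneg_combination[OF M] by metis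
    have ia: "i * a12 \<le> 0" "i * a13 \<le> 0" and ja: "j * a23 \<le> 0"
      using nn neg by (simp_all add: mult_nonneg_nonpos)
    have "k \<noteq> 0" using e(3) b ia ja by auto
    then have k: "1 \<le> k" using nn by simp
    have k32: "k * a32 \<le> a32" and k31: "k * a31 \<le> a31"
      using k neg mult_right_mono_neg[of 1 k] by force+
    from z \<open>k \<noteq> 0\<close> consider "j = 0" | "i = 0" "1 \<le> j" using nn by fastforce
    then show False
    proof cases
      case 1
      then show False using e(2) b k32 ia by simp
    next
      case 2
      then have "j * a21 \<le> a21"
        using neg mult_right_mono_neg[of 1 j a21] by simp
      then show False using e(1) 2 b k31 diag by simp
    qed
  qed
  \<comment> \<open>Row 1 trades \<open>a11 * x\<close> for multiples of \<open>y\<close> and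
    \<open>z\<close>. For \<open>?f + y\<close>, row 3 trades \<open>- a32 * y\<close> for multiples
    of \<open>x\<close> and \<open>z\<close>. Strict signs absorb each subtracted 1.\<close>
  moreover have "?f + x \<in> semigroup3 ?d"
    using neg diag row1 row3
    by (intro semigroup3I[of _ 0 _ "- a12 - a32 - 1" "- a13 - 1"]) (auto simp: algebra_simps)
  moreover have "?f + y = (a11 + a31 - 1) * x + 0 * y + (a33 - 1) * z"
    using row3 by (simp add: algebra_simps)
  then have "?f + y \<in> semigroup3 ?d"
    by (rule semigroup3I[of _ "a11 + a31 - 1" ?d 0 "a33 - 1", unfolded vector_3_nth])
      (use neg diag in auto)
  moreover have "?f + z \<in> semigroup3 ?d"
    using neg diag
    by (intro semigroup3I[of _ "a11 - 1" _ "- a32 - 1" 0]) (auto simp: algebra_simps)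
  ultimately show ?thesis
    unfolding pseudo_frobenius_def by (simp add: forall_3)
qed

lemma relation_matrix_not_symmetric:
  assumes M: "relation_matrix x y z a11 a12 a13 a21 a22 a23 a31 a32 a33"
  shows "\<not> symmetric_semigroup (semigroup3 (vector [x, y, z]))"
proof
  assume sym: "symmetric_semigroup (semigroup3 (vector [x, y, z]))"
  let ?F = "frobenius_number (semigroup3 (vector [x, y, z]))"
  have "a11 * x - a32 * y - (x + y + z) = ?F"
    using symmetric_pseudo_frobenius_unique[OF sym] relation_matrix_pseudo_frobenius[OF M] .
  \<comment> \<open>Swapping the last two generators puts \<open>a23\<close> in the place of
    \<open>a32\<close> and yields the second pseudo-Frobenius number.\<close>
  moreover have "a11 * x - a23 * z - (x + z + y) = ?F"
    using symmetric_pseudo_frobenius_unique[of "vector [x, z, y]"] sym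
      relation_matrix_pseudo_frobenius[OF relation_matrix_swap[OF M]]
    by (simp only: semigroup3_swap[of x z y])
  \<comment> \<open>If the two numbers agreed, \<open>- a32\<close> would be a positive multiplier
    of \<open>y\<close> smaller than \<open>a22\<close>, against the minimality of
    \<open>a22\<close>.\<close>
  ultimately have "(- a32) * y = (- a23) * z + 0 * x"
    by (simp add: algebra_simps)
  moreover have "a12 < 0" "a23 < 0" "a32 < 0" "a22 = - a12 - a32"
    using M unfolding relation_matrix_def by auto
  ultimately show False
    using relation_first_row[OF relation_matrix_rotate[OF M], of "- a32" "- a23" 0] by simp
qed

section \<open>Relation matrices are matrices of minimal relations\<close>

lemma triple_UNIV_3_cases:
  fixes i j k :: 3
  assumes "{i, j, k} = UNIV"
  shows "(i, j, k) \<in> {(1, 2, 3), (1, 3, 2), (2, 1, 3), (2, 3, 1), (3, 1, 2), (3, 2, 1)}"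
proof -
  have "\<forall>l. l = i \<or> l = j \<or> l = k"
    using assms by blast
  then show ?thesis
    using exhaust_3[of i] exhaust_3[of j] exhaust_3[of k] unfolding forall_3
    by (elim disjE) simp_all
qed

text \<open>Uniqueness: the least multipliers fix the diagonal, and the equality case of
  \<open>relation_first_row\<close> then fixes the rest of each row.\<close>

lemma minimal_relations_matrix_iff:
  assumes M: "relation_matrix x y z a11 a12 a13 a21 a22 a23 a31 a32 a33"
  shows "minimal_relations_matrix (vector [x, y, z]) A \<longleftrightarrow>
    A = vector [vector [a11, a12, a13], vector [a21, a22, a23], vector [a31, a32, a33]]"
    (is "?L \<longleftrightarrow> A = ?B")
proof -
  note M2 = relation_matrix_rotate[OF M]
  note M3 = relation_matrix_rotate[OF M2]
  \<comment> \<open>Rotations and swaps cover all six orders of \<open>(i, j, k)\<close> in the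
    definition.\<close>
  note least = relation_matrix_Least[OF M] relation_matrix_Least[OF M2] relation_matrix_Least[OF M3]
    relation_matrix_Least[OF relation_matrix_swap[OF M]]
    relation_matrix_Least[OF relation_matrix_swap[OF M2]]
    relation_matrix_Least[OF relation_matrix_swap[OF M3]]
  have neg: "a12 < 0" "a13 < 0" "a21 < 0" "a23 < 0" "a31 < 0" "a32 < 0"
    and diag: "a11 = - a21 - a31" "a22 = - a12 - a32" "a33 = - a13 - a23"
    and g: "gcd x (gcd y z) = 1"
    using M unfolding relation_matrix_def by auto
  show ?thesis
  proof
    assume L: ?L
    have "A $ i $ i = (LEAST v. 2 \<le> v \<and> (\<exists>vj vk. 0 \<le> vj \<and> 0 \<le> vk \<and>
        v * vector [x, y, z] $ i = vj * vector [x, y, z] $ j + vk * vector [x, y, z] $ k))"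
      if "{i, j, k} = UNIV" for i j k
      using L that unfolding minimal_relations_matrix_def by blast
    from this[of 1 2 3] this[of 2 3 1] this[of 3 1 2]
    have A: "A $ 1 $ 1 = a11" "A $ 2 $ 2 = a22" "A $ 3 $ 3 = a33"
      unfolding vector_3_nth least UNIV_3 by (simp_all add: insert_commute)
    have np: "A $ 1 $ 2 \<le> 0" "A $ 1 $ 3 \<le> 0" "A $ 2 $ 1 \<le> 0" "A $ 2 $ 3 \<le> 0"
      "A $ 3 $ 1 \<le> 0" "A $ 3 $ 2 \<le> 0"
      using L unfolding minimal_relations_matrix_def by simp_all
    have "A *v vector [x, y, z] = 0"
      using L unfolding minimal_relations_matrix_def by blast
    \<comment> \<open>The summands are ordered cyclically to fit the rotated matrices
      \<open>M2\<close> and \<open>M3\<close>.\<close>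
    then have eq: "a11 * x = (- A $ 1 $ 2) * y + (- A $ 1 $ 3) * z"
      "a22 * y = (- A $ 2 $ 3) * z + (- A $ 2 $ 1) * x"
      "a33 * z = (- A $ 3 $ 1) * x + (- A $ 3 $ 2) * y"
      by (simp_all add: vec_eq_iff forall_3 matrix_vector_mult_def sum_3 A)
    have "A $ 1 $ 2 = a12 \<and> A $ 1 $ 3 = a13"
      using relation_first_row[OF M eq(1)] np neg diag by simp
    moreover have "A $ 2 $ 3 = a23 \<and> A $ 2 $ 1 = a21"
      using relation_first_row[OF M2 eq(2)] np neg diag by simp
    moreover have "A $ 3 $ 1 = a31 \<and> A $ 3 $ 2 = a32"
      using relation_first_row[OF M3 eq(3)] np neg diag by simp
    ultimately show "A = ?B"
      by (simp add: vec_eq_iff forall_3 A)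
  next
    assume A: "A = ?B"
    have "numerical_generators (vector [x, y, z])"
      unfolding numerical_generators_def Gcd_range_3 vector_3_nth forall_3
      using g relation_matrix_pos[OF M] relation_matrix_pos[OF M2] relation_matrix_pos[OF M3] by simp
    moreover have "A *v vector [x, y, z] = 0"
      using relation_matrix_row[OF M] relation_matrix_row[OF M2] relation_matrix_row[OF M3]
      by (simp add: vec_eq_iff forall_3 matrix_vector_mult_def sum_3 A algebra_simps)
    moreover have "\<forall>i. Gcd (range (\<lambda>j. A $ i $ j)) = 1"
      using relation_matrix_gcd_row[OF M] relation_matrix_gcd_row[OF M2] relation_matrix_gcd_row[OF M3]
      unfolding Gcd_range_3 forall_3 A vector_3_nth by (simp add: ac_simps)
    moreover have "A $ i $ i = (LEAST v. 2 \<le> v \<and> (\<exists>vj vk. 0 \<le> vj \<and> 0 \<le> vk \<and>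
        v * vector [x, y, z] $ i = vj * vector [x, y, z] $ j + vk * vector [x, y, z] $ k))"
      if "{i, j, k} = UNIV" for i j k
      using triple_UNIV_3_cases[OF that]
      by (elim insertE emptyE) (simp_all only: prod.inject A vector_3_nth least)
    ultimately show ?L
      unfolding minimal_relations_matrix_def
      using relation_matrix_not_symmetric[OF M] neg diag by (simp add: forall_3 A)
  qed
qed

section \<open>Specialization to fourth powers of consecutive integers\<close>

text \<open>Reduces each residue class to six signs, three column sums and three polynomial
  identities.\<close>

lemma minimal_relations_matrix_fourth_powers_iff:
  fixes n :: int
  assumes "a12 < 0" "a13 < 0" "a21 < 0" "a23 < 0" "a31 < 0" "a32 < 0"
    and "a11 + a21 + a31 = 0" "a12 + a22 + a32 = 0" "a13 + a23 + a33 = 0"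
    and "(n - 1) ^ 4 = a22 * a33 - a23 * a32" "n ^ 4 = a11 * a33 - a13 * a31"
    and "(n + 1) ^ 4 = a11 * a22 - a12 * a21"
  shows "minimal_relations_matrix (fourth_powers n) A \<longleftrightarrow>
    A = vector [vector [a11, a12, a13], vector [a21, a22, a23], vector [a31, a32, a33]]"
proof -
  \<comment> \<open>Consecutive integers are coprime, so after reassociation the first two
    generators already give gcd 1.\<close>
  have "coprime ((n - 1) ^ 4) (n ^ 4)" by simp
  then have "gcd ((n - 1) ^ 4) (gcd (n ^ 4) ((n + 1) ^ 4)) = 1"
    by (simp add: gcd.assoc[symmetric] coprime_iff_gcd_eq_1 del: coprime_power_left_iff coprime_power_right_iff)
  then show ?thesis
    unfolding fourth_powers_def
    by (intro minimal_relations_matrix_iff) (use assms in \<open>simp add: relation_matrix_def\<close>)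
qed

(* With c the lower bound on m in each case of the theorem, every off-diagonal entry is a negative
   combination of 1, m - c and (m - c)^2. *)
lemma square_tangent_bound:
  fixes c m :: int
  assumes "c \<le> m"
  shows "c \<le> m \<and> 2 * (c * m) \<le> m^2 + c * c"
  using assms zero_le_square[of "m - c"] by (simp add: power2_eq_square algebra_simps)

theorem mainTheorem7:
  fixes n :: int and A :: "int ^ 3 ^ 3"
  assumes "4 \<le> n" and "even n"
    and "n \<notin> {6, 10, 14, 20, 26, 30, 40, 60, 80, 120}"
  shows "
    (\<forall>m\<ge>4. n = 40 * m \<longrightarrow>
       (minimal_relations_matrix (fourth_powers n) A \<longleftrightarrow> A = vector [
            vector [8160 * m^2 + 161 * m + 1, -(320 * m^2 - 1280 * m + 1), -(7840 * m^2 - 159 * m + 1)],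
            vector [-(160 * m^2 + m), 320 * m^2 + 1, -(160 * m^2 - m)],
            vector [-(8000 * m^2 + 160 * m + 1), -1280 * m, 8000 * m^2 - 160 * m + 1]])) \<and>
    (\<forall>m\<ge>1. n = 40 * m + 2 \<longrightarrow>
       (minimal_relations_matrix (fourth_powers n) A \<longleftrightarrow> A = vector [
            vector [4640 * m^2 + 526 * m + 15, -(4480 * m^2 + 64 * m + 6), -(160 * m^2 - 18 * m - 1)],
            vector [-(4400 * m^2 + 495 * m + 14), 4800 * m^2 + 160 * m + 11, -(400 * m^2 + 65 * m + 2)],
            vector [-(240 * m^2 + 31 * m + 1), -(320 * m^2 + 96 * m + 5), 560 * m^2 + 47 * m + 1]])) \<and>
    (\<forall>m\<ge>0. n = 40 * m + 4 \<longrightarrow>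
       (minimal_relations_matrix (fourth_powers n) A \<longleftrightarrow> A = vector [
            vector [2880 * m^2 + 616 * m + 33, -8 * (320 * m^2 + 32 * m + 1), -(320 * m^2 + 40 * m + 1)],
            vector [-(2240 * m^2 + 473 * m + 25), 2880 * m^2 + 448 * m + 25, -(640 * m^2 + 135 * m + 7)],
            vector [-(640 * m^2 + 143 * m + 8), -(320 * m^2 + 192 * m + 17), 960 * m^2 + 175 * m + 8]])) \<and>
    (\<forall>m\<ge>1. n = 40 * m + 6 \<longrightarrow>
       (minimal_relations_matrix (fourth_powers n) A \<longleftrightarrow> A = vector [
            vector [2800 * m^2 + 885 * m + 70, -(1600 * m^2 + 160 * m - 7), -(1200 * m^2 + 325 * m + 22)],
            vector [-(1760 * m^2 + 550 * m + 43), 1920 * m^2 + 448 * m + 30, -(160 * m^2 + 58 * m + 5)],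
            vector [-(1040 * m^2 + 335 * m + 27), -(320 * m^2 + 288 * m + 37), 1360 * m^2 + 383 * m + 27]])) \<and>
    (\<forall>m\<ge>0. n = 40 * m + 8 \<longrightarrow>
       (minimal_relations_matrix (fourth_powers n) A \<longleftrightarrow> A = vector [
            vector [2240 * m^2 + 932 * m + 97, -4 * (320 * m^2 + 64 * m + 1), -(960 * m^2 + 356 * m + 33)],
            vector [-(800 * m^2 + 325 * m + 33), 1600 * m^2 + 640 * m + 69, -(800 * m^2 + 315 * m + 31)],
            vector [-(1440 * m^2 + 607 * m + 64), -(320 * m^2 + 384 * m + 65), 1760 * m^2 + 671 * m + 64]])) \<and>
    (\<forall>m\<ge>1. n = 40 * m + 10 \<longrightarrow>
       (minimal_relations_matrix (fourth_powers n) A \<longleftrightarrow> A = vector [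
            vector [2480 * m^2 + 1283 * m + 166, -(960 * m^2 + 160 * m - 17), -(1520 * m^2 + 723 * m + 86)],
            vector [-(640 * m^2 + 324 * m + 41), 1280 * m^2 + 640 * m + 84, -(640 * m^2 + 316 * m + 39)],
            vector [-(1840 * m^2 + 959 * m + 125), -(320 * m^2 + 480 * m + 101), 2160 * m^2 + 1039 * m + 125]])) \<and>
    (\<forall>m\<ge>0. n = 40 * m + 12 \<longrightarrow>
       (minimal_relations_matrix (fourth_powers n) A \<longleftrightarrow> A = vector [
            vector [1280 * m^2 + 787 * m + 121, -(960 * m^2 + 448 * m + 51), -(320 * m^2 + 179 * m + 25)],
            vector [-(320 * m^2 + 183 * m + 26), 2240 * m^2 + 1472 * m + 247, -(1920 * m^2 + 1129 * m + 166)],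
            vector [-(960 * m^2 + 604 * m + 95), -(1280 * m^2 + 1024 * m + 196), 2240 * m^2 + 1308 * m + 191]])) \<and>
    (\<forall>m\<ge>1. n = 40 * m + 14 \<longrightarrow>
       (minimal_relations_matrix (fourth_powers n) A \<longleftrightarrow> A = vector [
            vector [2720 * m^2 + 1954 * m + 351, -(640 * m^2 + 64 * m - 54), -(2080 * m^2 + 1410 * m + 239)],
            vector [-(80 * m^2 + 51 * m + 8), 960 * m^2 + 736 * m + 143, -(880 * m^2 + 605 * m + 104)],
            vector [-(2640 * m^2 + 1903 * m + 343), -(320 * m^2 + 672 * m + 197), 2960 * m^2 + 2015 * m + 343]])) \<and>
    (\<forall>m\<ge>0. n = 40 * m + 16 \<longrightarrow>
       (minimal_relations_matrix (fourth_powers n) A \<longleftrightarrow> A = vector [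
            vector [1920 * m^2 + 1570 * m + 321, -(640 * m^2 + 256 * m + 2), -(1280 * m^2 + 994 * m + 193)],
            vector [-(800 * m^2 + 645 * m + 130), 1600 * m^2 + 1280 * m + 261, -(800 * m^2 + 635 * m + 126)],
            vector [-(1120 * m^2 + 925 * m + 191), -(960 * m^2 + 1024 * m + 259), 2080 * m^2 + 1629 * m + 319]])) \<and>
    (\<forall>m\<ge>0. n = 40 * m + 18 \<longrightarrow>
       (minimal_relations_matrix (fourth_powers n) A \<longleftrightarrow> A = vector [
            vector [1120 * m^2 + 1026 * m + 235, -(640 * m^2 + 448 * m + 74), -(480 * m^2 + 418 * m + 91)],
            vector [-(1040 * m^2 + 937 * m + 211), 2880 * m^2 + 2656 * m + 621, -(1840 * m^2 + 1639 * m + 365)],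
            vector [-(80 * m^2 + 89 * m + 24), -(2240 * m^2 + 2208 * m + 547), 2320 * m^2 + 2057 * m + 456]])) \<and>
    (\<forall>m\<ge>2. n = 40 * m + 20 \<longrightarrow>
       (minimal_relations_matrix (fourth_powers n) A \<longleftrightarrow> A = vector [
            vector [4160 * m^2 + 4241 * m + 1081, -(320 * m^2 - 320 * m - 239), -(3840 * m^2 + 3761 * m + 921)],
            vector [-(320 * m^2 + 322 * m + 81), 640 * m^2 + 640 * m + 162, -(320 * m^2 + 318 * m + 79)],
            vector [-(3840 * m^2 + 3919 * m + 1000), -(320 * m^2 + 960 * m + 401), 4160 * m^2 + 4079 * m + 1000]])) \<and>
    (\<forall>m\<ge>1. n = 40 * m - 18 \<longrightarrow>
       (minimal_relations_matrix (fourth_powers n) A \<longleftrightarrow> A = vector [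
            vector [2320 * m^2 - 2057 * m + 456, -(2240 * m^2 - 2208 * m + 547), -(80 * m^2 - 89 * m + 24)],
            vector [-(1840 * m^2 - 1639 * m + 365), 2880 * m^2 - 2656 * m + 621, -(1040 * m^2 - 937 * m + 211)],
            vector [-(480 * m^2 - 418 * m + 91), -(640 * m^2 - 448 * m + 74), 1120 * m^2 - 1026 * m + 235]])) \<and>
    (\<forall>m\<ge>1. n = 40 * m - 16 \<longrightarrow>
       (minimal_relations_matrix (fourth_powers n) A \<longleftrightarrow> A = vector [
            vector [2080 * m^2 - 1629 * m + 319, -(960 * m^2 - 1024 * m + 259), -(1120 * m^2 - 925 * m + 191)],
            vector [-(800 * m^2 - 635 * m + 126), 1600 * m^2 - 1280 * m + 261, -(800 * m^2 - 645 * m + 130)],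
            vector [-(1280 * m^2 - 994 * m + 193), -(640 * m^2 - 256 * m + 2), 1920 * m^2 - 1570 * m + 321]])) \<and>
    (\<forall>m\<ge>2. n = 40 * m - 14 \<longrightarrow>
       (minimal_relations_matrix (fourth_powers n) A \<longleftrightarrow> A = vector [
            vector [2960 * m^2 - 2015 * m + 343, -(320 * m^2 - 672 * m + 197), -(2640 * m^2 - 1903 * m + 343)],
            vector [-(880 * m^2 - 605 * m + 104), 960 * m^2 - 736 * m + 143, -(80 * m^2 - 51 * m + 8)],
            vector [-(2080 * m^2 - 1410 * m + 239), -(640 * m^2 - 64 * m - 54), 2720 * m^2 - 1954 * m + 351]])) \<and>
    (\<forall>m\<ge>1. n = 40 * m - 12 \<longrightarrow>
       (minimal_relations_matrix (fourth_powers n) A \<longleftrightarrow> A = vector [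
            vector [2240 * m^2 - 1308 * m + 191, -4 * (320 * m^2 - 256 * m + 49), -(960 * m^2 - 604 * m + 95)],
            vector [-(1920 * m^2 - 1129 * m + 166), 2240 * m^2 - 1472 * m + 247, -(320 * m^2 - 183 * m + 26)],
            vector [-(320 * m^2 - 179 * m + 25), -(960 * m^2 - 448 * m + 51), 1280 * m^2 - 787 * m + 121]])) \<and>
    (\<forall>m\<ge>2. n = 40 * m - 10 \<longrightarrow>
       (minimal_relations_matrix (fourth_powers n) A \<longleftrightarrow> A = vector [
            vector [2160 * m^2 - 1039 * m + 125, -(320 * m^2 - 480 * m + 101), -(1840 * m^2 - 959 * m + 125)],
            vector [-(640 * m^2 - 316 * m + 39), 1280 * m^2 - 640 * m + 84, -(640 * m^2 - 324 * m + 41)],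
            vector [-(1520 * m^2 - 723 * m + 86), -(960 * m^2 - 160 * m - 17), 2480 * m^2 - 1283 * m + 166]])) \<and>
    (\<forall>m\<ge>1. n = 40 * m - 8 \<longrightarrow>
       (minimal_relations_matrix (fourth_powers n) A \<longleftrightarrow> A = vector [
            vector [1760 * m^2 - 671 * m + 64, -(320 * m^2 - 384 * m + 65), -(1440 * m^2 - 607 * m + 64)],
            vector [-(800 * m^2 - 315 * m + 31), 1600 * m^2 - 640 * m + 69, -(800 * m^2 - 325 * m + 33)],
            vector [-(960 * m^2 - 356 * m + 33), -(1280 * m^2 - 256 * m + 4), 2240 * m^2 - 932 * m + 97]])) \<and>
    (\<forall>m\<ge>1. n = 40 * m - 6 \<longrightarrow>
       (minimal_relations_matrix (fourth_powers n) A \<longleftrightarrow> A = vector [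
            vector [1360 * m^2 - 383 * m + 27, -(320 * m^2 - 288 * m + 37), -(1040 * m^2 - 335 * m + 27)],
            vector [-(160 * m^2 - 58 * m + 5), 1920 * m^2 - 448 * m + 30, -(1760 * m^2 - 550 * m + 43)],
            vector [-(1200 * m^2 - 325 * m + 22), -(1600 * m^2 - 160 * m - 7), 2800 * m^2 - 885 * m + 70]])) \<and>
    (\<forall>m\<ge>1. n = 40 * m - 4 \<longrightarrow>
       (minimal_relations_matrix (fourth_powers n) A \<longleftrightarrow> A = vector [
            vector [960 * m^2 - 175 * m + 8, -(320 * m^2 - 192 * m + 17), -(640 * m^2 - 143 * m + 8)],
            vector [-(640 * m^2 - 135 * m + 7), 2880 * m^2 - 448 * m + 25, -(2240 * m^2 - 473 * m + 25)],
            vector [-(320 * m^2 - 40 * m + 1), -(2560 * m^2 - 256 * m + 8), 2880 * m^2 - 616 * m + 33]])) \<and>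
    (\<forall>m\<ge>1. n = 40 * m - 2 \<longrightarrow>
       (minimal_relations_matrix (fourth_powers n) A \<longleftrightarrow> A = vector [
            vector [560 * m^2 - 47 * m + 1, -(320 * m^2 - 96 * m + 5), -(240 * m^2 - 31 * m + 1)],
            vector [-(400 * m^2 - 65 * m + 2), 4800 * m^2 - 160 * m + 11, -(4400 * m^2 - 495 * m + 14)],
            vector [-(160 * m^2 + 18 * m - 1), -(4480 * m^2 - 64 * m + 6), 4640 * m^2 - 526 * m + 15]]))"
  \<comment> \<open>Each class is checked alone, \<open>c\<close> being its lower bound on
    \<open>m\<close>. Signs and column sums are linear once \<open>m^2\<close> is an atom, with
    \<open>distrib_left\<close> spreading factors such as \<open>-8\<close>; the fourth-power
    identities are expanded.\<close>
  by (intro conjI allI impI; hypsubst; drule square_tangent_bound;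
      rule minimal_relations_matrix_fourth_powers_iff;
      (linarith | simp only: distrib_left, linarith | simp add: power2_eq_square power4_eq_xxxx algebra_simps))

end
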